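(* Let $A\in\mathbb C^{n\times n}$, let $\lambda_0$ be a simple eigenvalue of $A$, and let $\varepsilon_0>0$ be as in the context. Given $\varepsilon\in(0,\varepsilon_0]$, assume $E=UTV^H\in\mathcal S_1\cap\mathcal M_2$ is a stationary point of $$\dot E=-P_E(S)+\mathrm{Re}\langle E,S\rangle\,E,\qquad E\in\mathcal S_1\cap\mathcal M_2,$$ (or equivalently of its factored form given in the context) such that $\lambda$ is not an eigenvalue of $A$ and $|y^Hx|<1$. Then $E=\mu S$ for some real $\mu$.
   Context: For $A,B\in\mathbb C^{n\times n}$, $\langle A,B\rangle=\mathrm{trace}(A^HB)$ and $\|A\|_F=\sqrt{\langle A,A\rangle}$. $\mathcal S_1=\{E\in\mathbb C^{n\times n}:\|E\|_F=1\}$. $\lambda_0$ is a simple eigenvalue of $A$, and $\varepsilon_0>0$ is fixed (it exists by continuity) such that for every $\varepsilon\in[0,\varepsilon_0]$ and $E\in\mathcal S_1$ the matrix $A+\varepsilon E$ has a simple eigenvalue $\lambda=\lambda(\varepsilon,E)$ close to $\lambda_0$ (the continuous continuation of $\lambda_0$, with $\lambda(0,E)=\lambda_0$). $x$ and $y$ are right and left eigenvectors of $A+\varepsilon E$ associated to $\lambda$, i.e. $(A+\varepsilon E)x=\lambda x$, $y^H(A+\varepsilon E)=\lambda y^H$, with $\|x\|_2=\|y\|_2=1$. For a singular matrix $M$ with a simple zero eigenvalue, its group inverse is the unique $G$ with $MG=GM$, $GMG=G$, $MGM=M$. $G$ denotes the group inverse of $A+\varepsilon E-\lambda I$, and $S=yy^HG^H+G^Hxx^H$.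 $\mathcal M_2$ is the manifold of matrices in $\mathbb C^{n\times n}$ of rank exactly $2$. Each $E\in\mathcal M_2$ can be written $E=UTV^H$ with $U,V\in\mathbb C^{n\times2}$ having orthonormal columns and $T\in\mathbb C^{2\times2}$ nonsingular; the orthogonal projection of $Z\in\mathbb C^{n\times n}$ onto the tangent space $T_E\mathcal M_2$ is $P_E(Z)=Z-(I-UU^H)Z(I-VV^H)$. Factored form of the system: with $p=U^Hy$, $q=V^Hx$, $r=U^HG^Hx$, $s=V^HGy$ (and the real part of the scalar coefficient of $T$, namely $\mathrm{Re}\langle E,S\rangle$, which is $s^HT^Hp+q^HT^Hr$ up to taking real parts), $\dot T=-(ps^H+rq^H)+\mathrm{Re}\langle E,S\rangle\,T$, $\ \dot U=-\big((y-Up)s^H+(G^Hx-Ur)q^H\big)T^{-1}$, $\ \dot V=-\big((Gy-Vs)p^H+(x-Vq)r^H\big)T^{-H}$. *)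

theory Defs
  imports "HOL-Analysis.Analysis" "HOL-Computational_Algebra.Polynomial"
begin

(* A complex matrix with m rows and n columns is an element of complex^'n^'m: the
   column index comes first in the type. In particular, n-by-2 matrices are complex^2^'n. *)

definition hermitian_transpose :: "complex^'n^'m \<Rightarrow> complex^'m^'n"  ("_\<^sup>H" [1000] 999)
  where "A\<^sup>H = (\<chi> i j. cnj (A $ j $ i))"

definition vcnj :: "complex^'n \<Rightarrow> complex^'n"
  where "vcnj v = (\<chi> i. cnj (v $ i))"

(* cdot y x is y^H x, conjugate-linear in the first argument *)
definition cdot :: "complex^'n \<Rightarrow> complex^'n \<Rightarrow> complex"
  where "cdot y x = (\<Sum>i\<in>UNIV. cnj (y $ i) * x $ i)"

(* outer u v is u v^H *)
definition outer :: "complex^'m \<Rightarrow> complex^'n \<Rightarrow> complex^'n^'m"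
  where "outer u v = (\<chi> i j. u $ i * cnj (v $ j))"

definition frob_inner :: "complex^'n^'n \<Rightarrow> complex^'n^'n \<Rightarrow> complex"
  where "frob_inner A B = trace (A\<^sup>H ** B)"

definition frob_norm :: "complex^'n^'n \<Rightarrow> real"
  where "frob_norm A = sqrt (Re (frob_inner A A))"

lemma Re_frob_inner: "Re (frob_inner A B) = A \<bullet> B"
proof -
  have "Re (frob_inner A B) = (\<Sum>i\<in>UNIV. \<Sum>k\<in>UNIV. A $ k $ i \<bullet> B $ k $ i)"
    by (simp add: frob_inner_def trace_def hermitian_transpose_def matrix_matrix_mult_def
        inner_complex_def)
  also have "\<dots> = A \<bullet> B"
    by (subst sum.swap) (simp add: inner_vec_def)
  finally show ?thesis .
qed

lemma frob_norm_eq_norm: "frob_norm A = norm A"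
  by (simp add: frob_norm_def Re_frob_inner norm_eq_sqrt_inner)

definition unit_matrices :: "(complex^'n^'n) set"
  where "unit_matrices = {E. frob_norm E = 1}"

definition rank2_matrices :: "(complex^'n^'n) set"
  where "rank2_matrices = {E. rank E = 2}"

definition charpoly :: "complex^'n^'n \<Rightarrow> complex poly"
  where "charpoly M = det (\<chi> i j. (if i = j then [:0, 1:] else 0) - [:M $ i $ j:])"

definition eigenvalue :: "complex^'n^'n \<Rightarrow> complex \<Rightarrow> bool"
  where "eigenvalue M l \<longleftrightarrow> (\<exists>v. v \<noteq> 0 \<and> M *v v = l *s v)"

(* simple means algebraic multiplicity one *)
definition simple_eigenvalue :: "complex^'n^'n \<Rightarrow> complex \<Rightarrow> bool"
  where "simple_eigenvalue M l \<longleftrightarrow> eigenvalue M l \<and> order l (charpoly M) = 1"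

definition unit_right_eigenvector :: "complex^'n^'n \<Rightarrow> complex \<Rightarrow> complex^'n \<Rightarrow> bool"
  where "unit_right_eigenvector M l x \<longleftrightarrow> M *v x = l *s x \<and> norm x = 1"

definition unit_left_eigenvector :: "complex^'n^'n \<Rightarrow> complex \<Rightarrow> complex^'n \<Rightarrow> bool"
  where "unit_left_eigenvector M l y \<longleftrightarrow> vcnj y v* M = l *s vcnj y \<and> norm y = 1"

(* lam e E is the continuation of the simple eigenvalue l0 of A along e \<mapsto> A + e E.
   Continuity in e alone suffices: since lam e E stays simple, it is determined by its
   value at e = 0. *)
definition eigenvalue_continuation ::
    "complex^'n^'n \<Rightarrow> complex \<Rightarrow> real \<Rightarrow> (real \<Rightarrow> complex^'n^'n \<Rightarrow> complex) \<Rightarrow> bool"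
  where "eigenvalue_continuation A l0 e0 lam \<longleftrightarrow>
    (\<forall>E\<in>unit_matrices.
       lam 0 E = l0 \<and>
       continuous_on {0..e0} (\<lambda>e. lam e E) \<and>
       (\<forall>e\<in>{0..e0}. simple_eigenvalue (A + e *\<^sub>R E) (lam e E)))"

definition is_group_inverse :: "complex^'n^'n \<Rightarrow> complex^'n^'n \<Rightarrow> bool"
  where "is_group_inverse M G \<longleftrightarrow> M ** G = G ** M \<and> G ** M ** G = G \<and> M ** G ** M = M"

lemma is_group_inverse_unique:
  assumes "is_group_inverse M G" and "is_group_inverse M G'"
  shows "G = G'"
proof -
  have 1: "M ** G = G ** M" "G ** M ** G = G" "M ** G ** M = M"
    and 2: "M ** G' = G' ** M" "G' ** M ** G' = G'" "M ** G' ** M = M"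
    using assms by (auto simp: is_group_inverse_def)
  have proj: "G ** M = G' ** M"
    using 1 2 by (metis matrix_mul_assoc)
  have "G = G ** (M ** G)" using 1(2) by (simp add: matrix_mul_assoc)
  also have "\<dots> = G ** (M ** G')" using proj 1(1) 2(1) by simp
  also have "\<dots> = G' ** M ** G'" using proj by (simp add: matrix_mul_assoc)
  finally show ?thesis using 2(2) by simp
qed

definition orthonormal_columns :: "complex^'k^'n \<Rightarrow> bool"
  where "orthonormal_columns U \<longleftrightarrow> U\<^sup>H ** U = mat 1"

definition rank2_factorization ::
    "complex^'n^'n \<Rightarrow> complex^2^'n \<Rightarrow> complex^2^2 \<Rightarrow> complex^2^'n \<Rightarrow> bool"
  where "rank2_factorization E U T V \<longleftrightarrow>
    orthonormal_columns U \<and> orthonormal_columns V \<and> invertible T \<and> E = U ** T ** V\<^sup>H"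

definition S_matrix :: "complex^'n \<Rightarrow> complex^'n \<Rightarrow> complex^'n^'n \<Rightarrow> complex^'n^'n"
  where "S_matrix x y G = outer y y ** G\<^sup>H + G\<^sup>H ** outer x x"

(* The projection P_E onto the tangent space at E = U T V^H; it depends on E only
   through U U^H and V V^H. *)
definition tangent_proj ::
    "complex^2^'n \<Rightarrow> complex^2^'n \<Rightarrow> complex^'n^'n \<Rightarrow> complex^'n^'n"
  where "tangent_proj U V Z = Z - (mat 1 - U ** U\<^sup>H) ** Z ** (mat 1 - V ** V\<^sup>H)"

(* E_rhs is the right-hand side of the differential equation for E, and T_rhs, U_rhs,
   V_rhs those of its factored form. The scalar coefficient of T is Re <E, S>. The
   arguments x, y, G are the eigenvectors and the group inverse belonging to E. *)
definition E_rhs ::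
    "complex^'n^'n \<Rightarrow> complex^2^'n \<Rightarrow> complex^2^'n \<Rightarrow>
     complex^'n \<Rightarrow> complex^'n \<Rightarrow> complex^'n^'n \<Rightarrow> complex^'n^'n"
  where "E_rhs E U V x y G =
    (let S = S_matrix x y G in - tangent_proj U V S + Re (frob_inner E S) *\<^sub>R E)"

definition T_rhs ::
    "complex^2^'n \<Rightarrow> complex^2^2 \<Rightarrow> complex^2^'n \<Rightarrow>
     complex^'n \<Rightarrow> complex^'n \<Rightarrow> complex^'n^'n \<Rightarrow> complex^2^2"
  where "T_rhs U T V x y G =
    (let p = U\<^sup>H *v y; q = V\<^sup>H *v x; r = U\<^sup>H *v (G\<^sup>H *v x); s = V\<^sup>H *v (G *v y)
     in - (outer p s + outer r q)
        + Re (frob_inner (U ** T ** V\<^sup>H) (S_matrix x y G)) *\<^sub>R T)"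

definition U_rhs ::
    "complex^2^'n \<Rightarrow> complex^2^2 \<Rightarrow> complex^2^'n \<Rightarrow>
     complex^'n \<Rightarrow> complex^'n \<Rightarrow> complex^'n^'n \<Rightarrow> complex^2^'n"
  where "U_rhs U T V x y G =
    (let p = U\<^sup>H *v y; q = V\<^sup>H *v x; r = U\<^sup>H *v (G\<^sup>H *v x); s = V\<^sup>H *v (G *v y)
     in - ((outer (y - U *v p) s + outer (G\<^sup>H *v x - U *v r) q) ** matrix_inv T))"

definition V_rhs ::
    "complex^2^'n \<Rightarrow> complex^2^2 \<Rightarrow> complex^2^'n \<Rightarrow>
     complex^'n \<Rightarrow> complex^'n \<Rightarrow> complex^'n^'n \<Rightarrow> complex^2^'n"
  where "V_rhs U T V x y G =
    (let p = U\<^sup>H *v y; q = V\<^sup>H *v x; r = U\<^sup>H *v (G\<^sup>H *v x); s = V\<^sup>H *v (G *v y)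
     in - ((outer (G *v y - V *v s) p + outer (x - V *v q) r) ** (matrix_inv T)\<^sup>H))"

end

theory Submission
  imports Defs
begin

text \<open>
  Write \<open>M = A + \<epsilon>E\<close>, \<open>N = M - \<lambda>I\<close>, \<open>a = Gy\<close> and \<open>b = G\<^sup>H x\<close>, so that \<open>S = y a\<^sup>H + b x\<^sup>H\<close> has rank at
  most two, like \<open>E\<close>. With \<open>\<rho> = Re \<langle>E, S\<rangle>\<close>, stationarity says \<open>P\<^sub>E(S) = \<rho>E\<close>. Compressing by the
  orthonormal factors of \<open>E\<close> turns this into the two one-sided equations
  \<open>U\<^sup>H S = \<rho> T V\<^sup>H\<close> and \<open>S V = \<rho> U T\<close>; the factored form of the system gives the same two
  equations (\<open>one_sided_equations_if_stationary\<close>).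

  If \<open>\<rho> \<noteq> 0\<close>, the second equation shows that the two columns of \<open>U\<close> are combinations of the two
  vectors \<open>y\<close> and \<open>b\<close>. By dimension both pairs span the same plane, hence \<open>U U\<^sup>H S = S\<close>, and the
  first equation becomes \<open>S = \<rho>E\<close> (\<open>outer_sum_eq_if_one_sided_equations\<close>).

  The case \<open>\<rho> = 0\<close> is the one that the spectral hypotheses exclude. Then \<open>S V = 0\<close>, which reads
  \<open>y (V\<^sup>H a)\<^sup>H + b (V\<^sup>H x)\<^sup>H = 0\<close>. The vector \<open>b\<close> is not a multiple of \<open>y\<close>: since
  \<open>y\<^sup>H N = 0\<close> and zero is a semisimple eigenvalue of \<open>N\<close>, an equation \<open>G\<^sup>H x = c y\<close> would
  make \<open>x\<close> itself a left null vector of \<open>N\<close> (\<open>group_inverse_left_null\<close>); since \<open>\<lambda>\<close> is simple, the left null space is a line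
  (\<open>simple_eigenvalue_left_eigenvectors\<close>), so \<open>x\<close> would be a multiple of \<open>y\<close> and
  \<open>\<bar>y\<^sup>H x\<bar> = 1\<close>. Consequently \<open>V\<^sup>H x = 0\<close>, thus \<open>E x = 0\<close> and \<open>A x = \<lambda> x\<close>, against the
  assumption that \<open>\<lambda>\<close> is not an eigenvalue of \<open>A\<close>.
\<close>

section \<open>Simple eigenvalues have one-dimensional left eigenspaces\<close>

lemma poly_det:
  fixes P :: "complex poly^'n^'n"
  shows "poly (det P) h = det (\<chi> i j. poly (P $ i $ j) h)"
  by (simp add: det_def poly_sum poly_prod of_int_poly[symmetric])

lemma poly_charpoly: "poly (charpoly M) h = det (mat h - M)"
proof -
  have "(\<chi> i j. poly ((if i = j then [:0, 1:] else 0) - [:M $ i $ j:]) h) = mat h - M"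
    by (simp add: vec_eq_iff mat_def)
  then show ?thesis
    unfolding charpoly_def poly_det by simp
qed

text \<open>The order of a root of the zero polynomial is an unspecified number, so the characteristic
  polynomial has to be known to be nonzero. Its reversal \<open>t \<mapsto> det (I - t M)\<close> has value \<open>1\<close> at \<open>0\<close>
  and agrees with it, up to a power of \<open>t\<close>, elsewhere.\<close>

lemma charpoly_nonzero:
  fixes M :: "complex^'n^'n"
  shows "charpoly M \<noteq> 0"
proof
  assume zero: "charpoly M = 0"
  define P :: "complex poly^'n^'n"
    where "P = (\<chi> i j. [:(if i = j then 1 else 0), - (M $ i $ j):])"
  have P: "poly (det P) t = det (mat 1 - (\<chi> i j. t * M $ i $ j))" for t
    unfolding poly_det P_def by (rule arg_cong[where f = det]) (simp add: vec_eq_iff mat_def)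
  have "poly (det P) t = 0" if "t \<noteq> 0" for t
  proof -
    have rows: "(\<chi> i. t *s (mat (1 / t) - M) $ i) = mat 1 - (\<chi> i j. t * M $ i $ j)"
      using that by (simp add: vec_eq_iff mat_def algebra_simps)
    have "det (\<chi> i. t *s (mat (1 / t) - M) $ i) = (\<Prod>i\<in>(UNIV::'n set). t) * det (mat (1 / t) - M)"
      using det_rows_mul[of "\<lambda>_. t" "\<lambda>i. (mat (1 / t) - M) $ i"] by (simp del: vector_minus_component)
    also have "det (mat (1 / t) - M) = 0"
      using poly_charpoly[of M "1 / t"] zero by simp
    finally show ?thesis
      using P[of t] rows by simp
  qed
  then have "UNIV - {0} \<subseteq> {t. poly (det P) t = 0}"
    by auto
  then have "infinite {t. poly (det P) t = 0}"
    using infinite_UNIV_char_0 by (meson finite.emptyI finite.insertI finite_Diff2 finite_subset)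
  then have "det P = 0"
    using poly_roots_finite by blast
  moreover have "poly (det P) 0 = 1"
    using P[of 0] by (simp add: zero_vec_def[symmetric])
  ultimately show False
    by simp
qed

text \<open>Two independent left eigenvectors \<open>v\<close>, \<open>w\<close> for \<open>l\<close> would make \<open>l\<close> a double root: by row
  operations two rows of \<open>hI - M\<close> can be replaced by \<open>(h - l)v\<close> and \<open>(h - l)w\<close>, which changes the
  determinant by a nonzero constant and exhibits the factor \<open>(h - l)\<^sup>2\<close>.\<close>

lemma simple_eigenvalue_left_eigenvectors:
  fixes M :: "complex^'n^'n"
  assumes simple: "simple_eigenvalue M l"
    and v: "v v* M = l *s v" "v \<noteq> 0" and w: "w v* M = l *s w"
  obtains c where "w = c *s v"
proof -
  obtain i where vi: "v $ i \<noteq> 0"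
    using v(2) by (auto simp: vec_eq_iff)
  \<comment> \<open>The multiple of \<open>v\<close> is fixed by the entry \<open>i\<close>; what remains has a zero there, so replacing row
    \<open>i\<close> by \<open>(h - l)v\<close> does not disturb the combination of rows given by \<open>u\<close>.\<close>
  define u where "u = w - (w $ i / v $ i) *s v"
  have ui: "u $ i = 0"
    using vi by (simp add: u_def)
  have u: "u v* M = l *s u"
    using v(1) w by (simp add: u_def vector_matrix_mult_diff_distrib scalar_vector_matrix_assoc
        vector_ssub_ldistrib vector_smult_assoc mult.commute)
  have comb: "(\<Sum>r\<in>UNIV. z $ r *s (mat h - M) $ r) = (h - l) *s z" if "z v* M = l *s z" for z h
  proof -
    have "(\<Sum>r\<in>UNIV. z $ r *s (mat h - M) $ r) = z v* mat h - z v* M"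
      by (simp add: vec_eq_iff vector_matrix_mult_def sum_subtractf algebra_simps)
    also have "z v* mat h = h *s z"
      by (simp add: vec_eq_iff vector_matrix_mult_def mat_def if_distrib cong: if_cong)
    finally show ?thesis
      using that by (simp add: vec_eq_iff algebra_simps)
  qed
  have "u = 0"
  proof (rule ccontr)
    assume "u \<noteq> 0"
    then obtain j where uj: "u $ j \<noteq> 0"
      by (auto simp: vec_eq_iff)
    then have ij: "j \<noteq> i"
      using ui by auto
    define R where "R h = (\<chi> r. if r = i then v else if r = j then u else (mat h - M) $ r)"
      for h :: complex
    define Q :: "complex poly^'n^'n" where
      "Q = (\<chi> r s. if r = i then [:v $ s:] else if r = j then [:u $ s:]
              else (if r = s then [:0, 1:] else 0) - [:M $ r $ s:])"
    have Q: "poly (det Q) h = det (R h)" for h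
      unfolding poly_det Q_def R_def
      by (rule arg_cong[where f = det]) (simp add: vec_eq_iff mat_def)
    have "u $ j * (v $ i * det (mat h - M)) = (h - l)\<^sup>2 * det (R h)" for h
    proof -
      have row_eq: "row r X = X $ r" for r and X :: "complex^'n^'n"
        by (simp add: row_def vec_lambda_eta)
      let ?N = "mat h - M"
      let ?N1 = "\<chi> r. if r = i then (h - l) *s v else ?N $ r"
      let ?N2 = "\<chi> r. if r = j then (h - l) *s u else ?N1 $ r"
      have N1: "v $ i * det ?N = det ?N1"
        using cramer_lemma_transpose[of i v ?N] comb[OF v(1), of h]
        by (simp only: row_eq)
      have "(\<Sum>r\<in>UNIV. u $ r *s ?N1 $ r) = (\<Sum>r\<in>UNIV. u $ r *s ?N $ r)"
        by (rule sum.cong) (auto simp: ui)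
      then have N2: "u $ j * det ?N1 = det ?N2"
        using cramer_lemma_transpose[of j u ?N1] comb[OF u, of h]
        by (simp only: row_eq)
      have "det ?N2 = (h - l) * det (\<chi> r. if r = j then u else ?N1 $ r)"
        by (rule det_row_mul)
      also have "(\<chi> r. if r = j then u else ?N1 $ r)
          = (\<chi> r. if r = i then (h - l) *s v else if r = j then u else ?N $ r)"
        using ij by (auto simp: vec_eq_iff)
      also have "det \<dots> = (h - l) * det (R h)"
        unfolding R_def by (rule det_row_mul)
      finally show ?thesis
        using N1 N2 by (simp add: power2_eq_square)
    qed
    then have "poly (smult (u $ j * v $ i) (charpoly M)) h = poly ([:- l, 1:]^2 * det Q) h" for h
      by (simp add: poly_charpoly Q algebra_simps)
    then have "smult (u $ j * v $ i) (charpoly M) = [:- l, 1:]^2 * det Q"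
      using poly_eq_poly_eq_iff by blast
    then have "[:- l, 1:]^2 dvd smult (u $ j * v $ i) (charpoly M)"
      by (metis dvd_triv_left)
    then have "[:- l, 1:]^2 dvd charpoly M"
      using uj vi by (simp add: dvd_smult_iff)
    then show False
      using simple charpoly_nonzero[of M] by (simp add: order_divides simple_eigenvalue_def)
  qed
  then have "w = (w $ i / v $ i) *s v"
    by (simp add: u_def)
  then show thesis
    by (rule that)
qed

text \<open>As \<open>G\<close> and \<open>N\<close> commute, \<open>N = G N\<^sup>2\<close>, and \<open>x\<close> is annihilated already by the first two
  factors \<open>G N\<close>.\<close>

lemma group_inverse_left_null:
  assumes "is_group_inverse N G" and y: "y v* N = 0" and x: "x v* G = c *s y"
  shows "x v* N = 0"
proof -
  have comm: "N ** G = G ** N" and G: "G ** N ** G = G" and N: "N ** G ** N = N"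
    using assms(1) by (auto simp: is_group_inverse_def)
  have "N = G ** N ** N"
    using comm N by simp
  then have "x v* N = ((x v* G) v* N) v* N"
    by (metis vector_matrix_mul_assoc)
  also have "\<dots> = 0"
    by (simp add: x scalar_vector_matrix_assoc y)
  finally show ?thesis .
qed

section \<open>Calculus of conjugate transposes and rank-one matrices\<close>

lemma matrix_diff_ldistrib:
  fixes A :: "'a::ring_1^'n^'m"
  shows "A ** (B - C) = A ** B - A ** C"
  by (simp add: vec_eq_iff matrix_matrix_mult_def right_diff_distrib sum_subtractf)

lemma matrix_diff_rdistrib:
  fixes A :: "'a::ring_1^'n^'m"
  shows "(A - B) ** C = A ** C - B ** C"
  by (simp add: vec_eq_iff matrix_matrix_mult_def left_diff_distrib sum_subtractf)

lemma matrix_add_rdistrib: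
  fixes A :: "'a::semiring_1^'n^'m"
  shows "(A + B) ** C = A ** C + B ** C"
  by (simp add: vec_eq_iff matrix_matrix_mult_def distrib_right sum.distrib)

lemma matrix_scaleR_left:
  fixes A :: "complex^'n^'m" and B :: "complex^'k^'n"
  shows "(c *\<^sub>R A) ** B = c *\<^sub>R (A ** B)"
  by (simp add: vec_eq_iff matrix_matrix_mult_def scaleR_sum_right)

lemma matrix_scaleR_right:
  fixes A :: "complex^'n^'m" and B :: "complex^'k^'n"
  shows "A ** (c *\<^sub>R B) = c *\<^sub>R (A ** B)"
  by (simp add: vec_eq_iff matrix_matrix_mult_def scaleR_sum_right)

lemma hermitian_transpose_twice: "(A\<^sup>H)\<^sup>H = A"
  by (simp add: hermitian_transpose_def vec_eq_iff)

lemma hermitian_transpose_mult: "(A ** B)\<^sup>H = B\<^sup>H ** A\<^sup>H"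
  by (simp add: hermitian_transpose_def vec_eq_iff matrix_matrix_mult_def mult.commute)

lemma outer_diff_left: "outer (u - w) v = outer u v - outer w v"
  by (simp add: outer_def vec_eq_iff left_diff_distrib)

lemma matrix_mult_outer: "A ** outer u v = outer (A *v u) v"
  by (simp add: outer_def vec_eq_iff matrix_matrix_mult_def matrix_vector_mult_def
      sum_distrib_right mult.assoc)

lemma outer_mult_matrix: "outer u v ** A = outer u (A\<^sup>H *v v)"
  by (simp add: outer_def vec_eq_iff matrix_matrix_mult_def matrix_vector_mult_def
      hermitian_transpose_def sum_distrib_left mult_ac)

lemma hermitian_transpose_outer_sum:
  "(outer u v + outer w z)\<^sup>H = outer v u + outer z w"
  by (simp add: outer_def vec_eq_iff hermitian_transpose_def mult.commute)

lemma S_matrix_eq: "S_matrix x y G = outer y (G *v y) + outer (G\<^sup>H *v x) x"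
  by (simp add: S_matrix_def matrix_mult_outer outer_mult_matrix hermitian_transpose_twice)

lemma vcnj_hermitian_transpose_mult: "vcnj (G\<^sup>H *v x) = vcnj x v* G"
  by (simp add: vcnj_def vec_eq_iff hermitian_transpose_def matrix_vector_mult_def
      vector_matrix_mult_def mult.commute)

lemma vcnj_vcnj: "vcnj (vcnj x) = x"
  by (simp add: vcnj_def vec_eq_iff)

lemma vcnj_smult: "vcnj (c *s x) = cnj c *s vcnj x"
  by (simp add: vcnj_def vec_eq_iff)

lemma cdot_self: "cdot y y = of_real ((norm y)\<^sup>2)"
  by (simp add: cdot_def norm_vec_def L2_set_def sum_nonneg complex_norm_square[symmetric]
      mult.commute del: of_real_power)

lemma cmod_cdot_unit_multiple:
  assumes "norm x = 1" and "norm y = 1" and "x = c *s y"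
  shows "cmod (cdot y x) = 1"
proof -
  have "cdot y x = c * cdot y y" and "cdot x x = cnj c * c * cdot y y"
    using assms(3) by (simp_all add: cdot_def sum_distrib_left mult_ac)
  then have "cdot y x = c" and "c * cnj c = 1"
    using assms(1,2) by (simp_all add: cdot_self mult.commute)
  then show ?thesis
    by (metis complex_mod_sqrt_Re_mult_cnj one_complex.simps(1) real_sqrt_one)
qed

text \<open>\<open>y s\<^sup>H\<close> and \<open>b q\<^sup>H\<close> cancel only if \<open>q\<close> vanishes, since a nonzero entry of \<open>q\<close> can be
  divided out in the corresponding column.\<close>

lemma outer_sum_zero:
  assumes zero: "outer y s + outer b q = 0" and "\<And>c. b \<noteq> c *s y"
  shows "q = 0"
proof (rule ccontr)
  assume "q \<noteq> 0"
  then obtain k where k: "q $ k \<noteq> 0"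
    by (auto simp: vec_eq_iff)
  have "y $ i * cnj (s $ k) + b $ i * cnj (q $ k) = 0" for i
    using arg_cong[OF zero, of "\<lambda>X. X $ i $ k"] by (simp add: outer_def)
  then have "b $ i * cnj (q $ k) = - cnj (s $ k) * y $ i" for i
    by (simp add: eq_neg_iff_add_eq_0 add.commute mult.commute)
  then have "b = (- cnj (s $ k) / cnj (q $ k)) *s y"
    using k by (simp add: vec_eq_iff field_simps)
  then show False
    using assms(2) by blast
qed

lemma matrix_mul_matrix_inv:
  assumes "invertible A"
  shows "A ** matrix_inv A = mat 1" and "matrix_inv A ** A = mat 1"
  using someI_ex[OF assms[unfolded invertible_def]] by (simp_all add: matrix_inv_def)

section \<open>Stationary points\<close>

text \<open>In the factored form the equation for \<open>T\<close> is the two-sided compression \<open>U\<^sup>H S V = \<rho> T\<close>.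
  Since \<open>T\<close> is invertible, the equation for \<open>U\<close> says \<open>(I - U U\<^sup>H) S V = 0\<close>, which extends the
  compression to \<open>S V\<close>; the one for \<open>V\<close> says \<open>(I - V V\<^sup>H) S\<^sup>H U = 0\<close>, which extends it to
  \<open>U\<^sup>H S\<close> after taking adjoints.\<close>

lemma one_sided_equations_if_stationary:
  fixes E G :: "complex^'n^'n" and U V :: "complex^2^'n" and T :: "complex^2^2"
  assumes fac: "rank2_factorization E U T V"
    and stat: "E_rhs E U V x y G = 0 \<or>
         (T_rhs U T V x y G = 0 \<and> U_rhs U T V x y G = 0 \<and> V_rhs U T V x y G = 0)"
  defines "S \<equiv> S_matrix x y G"
  defines "\<rho> \<equiv> Re (frob_inner E S)"
  shows "U\<^sup>H ** S = \<rho> *\<^sub>R (T ** V\<^sup>H)" and "S ** V = \<rho> *\<^sub>R (U ** T)"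
proof -
  have U: "U\<^sup>H ** U = mat 1" and V: "V\<^sup>H ** V = mat 1"
    and T: "invertible T" and E: "E = U ** T ** V\<^sup>H"
    using fac by (auto simp: rank2_factorization_def orthonormal_columns_def)
  have UE: "U\<^sup>H ** E = T ** V\<^sup>H" and EV: "E ** V = U ** T"
    using U V by (simp_all add: E matrix_mul_assoc) (simp add: matrix_mul_assoc[symmetric])
  have "U\<^sup>H ** S = \<rho> *\<^sub>R (T ** V\<^sup>H) \<and> S ** V = \<rho> *\<^sub>R (U ** T)"
    using stat
  proof
    assume "E_rhs E U V x y G = 0"
    then have eq: "S - (mat 1 - U ** U\<^sup>H) ** S ** (mat 1 - V ** V\<^sup>H) = \<rho> *\<^sub>R E"
      by (simp add: E_rhs_def Let_def tangent_proj_def S_def \<rho>_def add_eq_0_iff algebra_simps)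
    \<comment> \<open>The complementary projections are annihilated by \<open>U\<^sup>H\<close> on the left and by \<open>V\<close> on the right.\<close>
    have "U\<^sup>H ** (mat 1 - U ** U\<^sup>H) = 0"
      using U by (simp add: matrix_diff_ldistrib matrix_mul_assoc)
    then have "U\<^sup>H ** S = U\<^sup>H ** (\<rho> *\<^sub>R E)"
      by (simp add: eq[symmetric] matrix_diff_ldistrib[of _ S] matrix_mul_assoc)
    moreover have "(mat 1 - V ** V\<^sup>H) ** V = 0"
      using V by (simp add: matrix_diff_rdistrib matrix_mul_assoc[symmetric])
    then have "S ** V = (\<rho> *\<^sub>R E) ** V"
      by (simp add: eq[symmetric] matrix_diff_rdistrib[of S] matrix_mul_assoc[symmetric])
    ultimately show ?thesis
      by (simp add: matrix_scaleR_left matrix_scaleR_right UE EV)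
  next
    assume rhs: "T_rhs U T V x y G = 0 \<and> U_rhs U T V x y G = 0 \<and> V_rhs U T V x y G = 0"
    define a where "a = G *v y"
    define b where "b = G\<^sup>H *v x"
    define p where "p = U\<^sup>H *v y"
    define q where "q = V\<^sup>H *v x"
    define r where "r = U\<^sup>H *v b"
    define s where "s = V\<^sup>H *v a"
    have S: "S = outer y a + outer b x"
      by (simp add: S_def S_matrix_eq a_def b_def)
    have SV: "S ** V = outer y s + outer b q"
      by (simp add: S matrix_add_rdistrib outer_mult_matrix s_def q_def)
    have US: "U\<^sup>H ** S = outer p a + outer r x"
      by (simp add: S matrix_add_ldistrib matrix_mult_outer p_def r_def)
    have core: "outer p s + outer r q = \<rho> *\<^sub>R T"
      using rhs by (simp add: T_rhs_def Let_def E S_def \<rho>_def p_def q_def r_def s_def a_def b_def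
          add_eq_0_iff algebra_simps)
    have TT: "matrix_inv T ** T = mat 1" and TH: "(matrix_inv T)\<^sup>H ** T\<^sup>H = mat 1"
    proof -
      show 1: "matrix_inv T ** T = mat 1"
        using T by (rule matrix_mul_matrix_inv)
      have "(T ** matrix_inv T)\<^sup>H = mat 1"
        using matrix_mul_matrix_inv(1)[OF T] by (simp add: hermitian_transpose_def vec_eq_iff mat_def)
      then show "(matrix_inv T)\<^sup>H ** T\<^sup>H = mat 1"
        by (simp add: hermitian_transpose_mult)
    qed
    have cancelT: "X = 0" if "X ** K = 0" "K ** L = mat 1" for X :: "complex^2^'n" and K L
      using that by (metis matrix_mul_assoc matrix_mul_rid times0_left)
    have "(outer (y - U *v p) s + outer (b - U *v r) q) ** matrix_inv T = 0"
      using rhs by (simp add: U_rhs_def Let_def p_def q_def r_def s_def a_def b_def)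
    then have "outer (y - U *v p) s + outer (b - U *v r) q = 0"
      using TT by (rule cancelT)
    then have "S ** V = U ** (outer p s + outer r q)"
      by (simp add: SV outer_diff_left matrix_add_ldistrib matrix_mult_outer algebra_simps)
    then have *: "S ** V = \<rho> *\<^sub>R (U ** T)"
      by (simp add: core matrix_scaleR_right)
    have "(outer (a - V *v s) p + outer (x - V *v q) r) ** (matrix_inv T)\<^sup>H = 0"
      using rhs by (simp add: V_rhs_def Let_def p_def q_def r_def s_def a_def b_def)
    then have "outer (a - V *v s) p + outer (x - V *v q) r = 0"
      using TH by (rule cancelT)
    then have "outer a p + outer x r = V ** (outer s p + outer q r)"
      by (simp add: outer_diff_left matrix_add_ldistrib matrix_mult_outer algebra_simps)
    then have "(outer a p + outer x r)\<^sup>H = (V ** (outer s p + outer q r))\<^sup>H"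
      by simp
    then have "U\<^sup>H ** S = (outer p s + outer r q) ** V\<^sup>H"
      by (simp only: US hermitian_transpose_mult hermitian_transpose_outer_sum)
    then show ?thesis
      using * by (simp add: core matrix_scaleR_left)
  qed
  then show "U\<^sup>H ** S = \<rho> *\<^sub>R (T ** V\<^sup>H)" and "S ** V = \<rho> *\<^sub>R (U ** T)"
    by auto
qed

text \<open>Let \<open>Y\<close> be the matrix with columns \<open>y\<close> and \<open>b\<close>. The right equation gives \<open>U = Y K\<close> for a
  2-by-2 matrix \<open>K\<close>. As \<open>U\<^sup>H U = I\<close>, the matrix \<open>U\<^sup>H Y\<close> is a left inverse of \<open>K\<close>; for
  square matrices it is then also a right inverse, so \<open>U U\<^sup>H Y = Y K U\<^sup>H Y = Y\<close>: the projection fixes the whole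
  range of \<open>S\<close>.\<close>

lemma outer_sum_eq_if_one_sided_equations:
  fixes S :: "complex^'n^'n" and U V :: "complex^2^'n" and T :: "complex^2^2"
  assumes U: "U\<^sup>H ** U = mat 1" and T: "invertible T" and "\<rho> \<noteq> 0"
    and S: "S = outer y a + outer b x"
    and left: "U\<^sup>H ** S = \<rho> *\<^sub>R (T ** V\<^sup>H)" and right: "S ** V = \<rho> *\<^sub>R (U ** T)"
  shows "S = \<rho> *\<^sub>R (U ** T ** V\<^sup>H)"
proof -
  define Y :: "complex^2^'n" where "Y = (\<chi> i k. if k = 1 then y $ i else b $ i)"
  define Z :: "complex^2^'n" where "Z = (\<chi> i k. if k = 1 then a $ i else x $ i)"
  have S': "S = Y ** Z\<^sup>H"
    by (simp add: S Y_def Z_def vec_eq_iff outer_def hermitian_transpose_def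
        matrix_matrix_mult_def sum_2)
  define K where "K = (1 / \<rho>) *\<^sub>R (Z\<^sup>H ** V ** matrix_inv T)"
  have "Y ** K = (1 / \<rho>) *\<^sub>R (S ** V ** matrix_inv T)"
    by (simp add: K_def S' matrix_scaleR_right matrix_mul_assoc)
  also have "\<dots> = U ** (T ** matrix_inv T)"
    using \<open>\<rho> \<noteq> 0\<close> by (simp add: right matrix_scaleR_left matrix_mul_assoc)
  also have "\<dots> = U"
    by (simp add: matrix_mul_matrix_inv(1)[OF T])
  finally have K: "Y ** K = U" .
  then have "(U\<^sup>H ** Y) ** K = mat 1"
    using U by (simp add: matrix_mul_assoc[symmetric])
  then have "K ** (U\<^sup>H ** Y) = mat 1"
    by (simp add: matrix_left_right_inverse)
  then have "Y = Y ** (K ** (U\<^sup>H ** Y))"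
    by simp
  also have "\<dots> = U ** (U\<^sup>H ** Y)"
    using K by (simp add: matrix_mul_assoc)
  finally have "S = U ** (U\<^sup>H ** S)"
    unfolding S' by (metis matrix_mul_assoc)
  then show ?thesis
    by (simp add: left matrix_scaleR_right matrix_mul_assoc)
qed

theorem theorem4p4:
  fixes A E G :: "complex^'n^'n"
    and U V :: "complex^2^'n" and T :: "complex^2^2"
    and x y :: "complex^'n"
    and lam0 :: complex and \<epsilon>\<^sub>0 \<epsilon> :: real
    and lam :: "real \<Rightarrow> complex^'n^'n \<Rightarrow> complex"
  assumes "simple_eigenvalue A lam0"
    and "\<epsilon>\<^sub>0 > 0"
    and "eigenvalue_continuation A lam0 \<epsilon>\<^sub>0 lam"
    and "\<epsilon> \<in> {0<..\<epsilon>\<^sub>0}"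
    and "E \<in> unit_matrices \<inter> rank2_matrices"
    and "rank2_factorization E U T V"
    and "unit_right_eigenvector (A + \<epsilon> *\<^sub>R E) (lam \<epsilon> E) x"
    and "unit_left_eigenvector (A + \<epsilon> *\<^sub>R E) (lam \<epsilon> E) y"
    and "is_group_inverse (A + \<epsilon> *\<^sub>R E - mat (lam \<epsilon> E)) G"
    and "E_rhs E U V x y G = 0 \<or>
         (T_rhs U T V x y G = 0 \<and> U_rhs U T V x y G = 0 \<and> V_rhs U T V x y G = 0)"
    and "\<not> eigenvalue A (lam \<epsilon> E)"
    and "cmod (cdot y x) < 1"
  shows "\<exists>\<mu>::real. E = \<mu> *\<^sub>R S_matrix x y G"
proof -
  define l where "l = lam \<epsilon> E"
  define M where "M = A + \<epsilon> *\<^sub>R E"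
  define S where "S = S_matrix x y G"
  define \<rho> where "\<rho> = Re (frob_inner E S)"
  define b where "b = G\<^sup>H *v x"
  have simple: "simple_eigenvalue M l"
    using assms(3,4,5) by (auto simp: eigenvalue_continuation_def M_def l_def)
  have Mx: "M *v x = l *s x" and nx: "norm x = 1"
    using assms(7) by (auto simp: unit_right_eigenvector_def M_def l_def)
  have yM: "vcnj y v* M = l *s vcnj y" and ny: "norm y = 1"
    using assms(8) by (auto simp: unit_left_eigenvector_def M_def l_def)
  have U: "U\<^sup>H ** U = mat 1" and T: "invertible T" and E: "E = U ** T ** V\<^sup>H"
    using assms(6) by (auto simp: rank2_factorization_def orthonormal_columns_def)
  have S: "S = outer y (G *v y) + outer b x"
    by (simp add: S_def b_def S_matrix_eq)
  note eqs = one_sided_equations_if_stationary[OF assms(6) assms(10), folded S_def, folded \<rho>_def]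
  have left_null: "z v* (M - mat l) = z v* M - l *s z" for z
    by (simp add: vector_matrix_mult_diff_rdistrib)
      (simp add: vec_eq_iff vector_matrix_mult_def mat_def if_distrib cong: if_cong)
  have indep: "b \<noteq> c *s y" for c
  proof
    assume "b = c *s y"
    then have "vcnj x v* G = cnj c *s vcnj y"
      by (simp add: b_def flip: vcnj_hermitian_transpose_mult vcnj_smult)
    moreover have "vcnj y v* (M - mat l) = 0"
      using yM by (simp add: left_null)
    moreover have "is_group_inverse (M - mat l) G"
      using assms(9) by (simp add: M_def l_def)
    ultimately have "vcnj x v* (M - mat l) = 0"
      using group_inverse_left_null by blast
    then have "vcnj x v* M = l *s vcnj x"
      by (simp add: left_null)
    moreover have "vcnj y \<noteq> 0"
    proof
      assume "vcnj y = 0"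
      then have "y = 0"
        by (simp add: vcnj_def vec_eq_iff)
      then show False
        using ny by simp
    qed
    ultimately obtain d where "vcnj x = d *s vcnj y"
      using simple_eigenvalue_left_eigenvectors[OF simple yM] by blast
    then have "x = cnj d *s y"
      by (metis vcnj_smult vcnj_vcnj)
    then have "cmod (cdot y x) = 1"
      by (rule cmod_cdot_unit_multiple[OF nx ny])
    then show False
      using assms(12) by simp
  qed
  have "\<rho> \<noteq> 0"
  proof
    assume "\<rho> = 0"
    then have "S ** V = 0"
      using eqs(2) by simp
    then have "outer y (V\<^sup>H *v (G *v y)) + outer b (V\<^sup>H *v x) = 0"
      by (simp add: S matrix_add_rdistrib outer_mult_matrix)
    then have "V\<^sup>H *v x = 0"
      using indep by (rule outer_sum_zero)
    then have "E *v x = 0"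
      by (simp add: E matrix_vector_mul_assoc[symmetric])
    then have "A *v x = l *s x"
      using Mx by (simp add: M_def matrix_vector_mult_def vec_eq_iff distrib_right sum.distrib
          flip: scaleR_sum_right)
    then show False
      using assms(11) nx unfolding eigenvalue_def l_def by (metis norm_zero zero_neq_one)
  qed
  then have "S = \<rho> *\<^sub>R E"
    using outer_sum_eq_if_one_sided_equations[OF U T _ S eqs] E by simp
  then have "E = (1 / \<rho>) *\<^sub>R S"
    using \<open>\<rho> \<noteq> 0\<close> by simp
  then show ?thesis
    unfolding S_def by blast
qed

end
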